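(* Let $\ell>0$, let $\bar p>0$ be a constant pressure and let $s\in\mathcal B$. Then there is a monotone increasing sequence $(\omega_k)_{k\ge1}$ of eigenfrequencies with $\omega_k/k$ bounded, and corresponding eigenfunctions $\varphi_k,\psi_k$ on $[0,\ell]$, such that for each $k\ge 1$ the functions $$P_k(x,t)=\varphi_k(x)\cos(\omega_kt),\qquad U_k(x,t)=\psi_k(x)\sin(\omega_kt)$$ solve the linear wave equation $$P_x+U_t=0,\qquad U_x+\sigma^2(x)P_t=0\qquad (0<x<\ell)$$ together with the boundary conditions $U(0,\cdot)=0$, $P(0,\cdot)$ even, and $$\tfrac{\mathcal I-\mathcal R}{2}\mathcal S^{T/4}U(\ell,\cdot)=0,\qquad \tfrac{\mathcal I-\mathcal R}{2}\mathcal S^{T/4}P(\ell,\cdot)=0,\qquad T=T_k:=\frac{2\pi k}{\omega_k}.$$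
   Context: $v=v(p,s)$ is a given smooth constitutive law (specific volume as a function of pressure and entropy) with $v_p<0$. The inverse linearized wavespeed at the quiet state $(p,u)=(\bar p,0)$ with entropy $s(x)$ is $\sigma(x)=\sqrt{-v_p(\bar p,s(x))}$. The set of allowable entropy profiles is $\mathcal B=\{s\in L^1[0,\ell] : \sigma\in L^1,\ \log\sigma\in BV\}$. Operators on functions of $t$: $\mathcal I$ is the identity, $\mathcal Rf(t)=f(-t)$, $\mathcal S^{T/4}f(t)=f(t-T/4)$; $\frac{\mathcal I-\mathcal R}{2}$ projects onto the odd part. An eigenfrequency is the square root of an eigenvalue of the Sturm–Liouville problem $-\ddot\varphi=\omega^2\sigma^2\varphi$ obtained by separating variables (equivalently $\dot\varphi+\omega\psi=0$, $\dot\psi-\sigma^2\omega\varphi=0$) under these boundary conditions; eigenfunctions are nontrivial. The functions $P_k,U_k$ are called the pure tone ($k$-mode) solutions of the linearized equation. *)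

theory Defs
  imports "HOL-Analysis.Analysis"
begin

text \<open>Class C^n for functions of two real variables on an open set: all partial
  derivatives up to order n exist and are continuous.\<close>

primrec C_class_on :: "nat \<Rightarrow> (real \<times> real) set \<Rightarrow> (real \<Rightarrow> real \<Rightarrow> real) \<Rightarrow> bool" where
  "C_class_on 0 D f \<longleftrightarrow> continuous_on D (\<lambda>(p, s). f p s)"
| "C_class_on (Suc n) D f \<longleftrightarrow>
     continuous_on D (\<lambda>(p, s). f p s) \<and>
     (\<exists>f1 f2. (\<forall>(p, s)\<in>D. ((\<lambda>p'. f p' s) has_real_derivative f1 p s) (at p) \<and>
                          ((\<lambda>s'. f p s') has_real_derivative f2 p s) (at s)) \<and>
              C_class_on n D f1 \<and> C_class_on n D f2)"

definition smooth2_on :: "(real \<times> real) set \<Rightarrow> (real \<Rightarrow> real \<Rightarrow> real) \<Rightarrow> bool" where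
  "smooth2_on D f \<longleftrightarrow> (\<forall>n. C_class_on n D f)"

text \<open>The law is given for positive pressures and arbitrary entropies.\<close>

definition constitutive_law :: "(real \<Rightarrow> real \<Rightarrow> real) \<Rightarrow> bool" where
  "constitutive_law v \<longleftrightarrow>
     smooth2_on ({0<..} \<times> UNIV) v \<and> (\<forall>p>0. \<forall>s. deriv (\<lambda>p'. v p' s) p < 0)"

definition inv_wavespeed :: "(real \<Rightarrow> real \<Rightarrow> real) \<Rightarrow> real \<Rightarrow> (real \<Rightarrow> real) \<Rightarrow> real \<Rightarrow> real" where
  "inv_wavespeed v pbar s x = sqrt (- deriv (\<lambda>p. v p (s x)) pbar)"

definition finite_variation_on :: "real set \<Rightarrow> (real \<Rightarrow> real) \<Rightarrow> bool" where
  "finite_variation_on S f \<longleftrightarrow>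
     (\<exists>C. \<forall>n (x :: nat \<Rightarrow> real). (\<forall>i\<le>n. x i \<in> S) \<and> (\<forall>i<n. x i \<le> x (Suc i)) \<longrightarrow>
        (\<Sum>i<n. \<bar>f (x (Suc i)) - f (x i)\<bar>) \<le> C)"

text \<open>Elements of L^1 are classes modulo null sets, so membership in BV means that some
  representative has finite total variation.\<close>

definition BV_on :: "real set \<Rightarrow> (real \<Rightarrow> real) \<Rightarrow> bool" where
  "BV_on S f \<longleftrightarrow>
     f absolutely_integrable_on S \<and>
     (\<exists>g. finite_variation_on S g \<and> (AE x in lebesgue. x \<in> S \<longrightarrow> f x = g x))"

definition entropy_profiles :: "(real \<Rightarrow> real \<Rightarrow> real) \<Rightarrow> real \<Rightarrow> real \<Rightarrow> (real \<Rightarrow> real) set" where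
  "entropy_profiles v pbar l =
     {s. s absolutely_integrable_on {0..l} \<and>
         inv_wavespeed v pbar s absolutely_integrable_on {0..l} \<and>
         BV_on {0..l} (\<lambda>x. ln (inv_wavespeed v pbar s x))}"

text \<open>The finite families of non-overlapping intervals [a i, b i] are listed from left to right.\<close>

definition abs_continuous_on :: "real set \<Rightarrow> (real \<Rightarrow> real) \<Rightarrow> bool" where
  "abs_continuous_on S f \<longleftrightarrow>
     (\<forall>e>0. \<exists>d>0. \<forall>n (a :: nat \<Rightarrow> real) b.
        (\<forall>i<n. a i \<in> S \<and> b i \<in> S \<and> a i \<le> b i) \<and>
        (\<forall>i. Suc i < n \<longrightarrow> b i \<le> a (Suc i)) \<and> (\<Sum>i<n. b i - a i) < d \<longrightarrow>
        (\<Sum>i<n. \<bar>f (b i) - f (a i)\<bar>) < e)"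

text \<open>The coefficient may jump and is determined only up to null sets, so solutions are
  absolutely continuous in x and satisfy the equations at almost every x (for all t).
  Functions of position and time take the position first.\<close>

definition solves_linear_wave ::
  "real \<Rightarrow> (real \<Rightarrow> real) \<Rightarrow> (real \<Rightarrow> real \<Rightarrow> real) \<Rightarrow> (real \<Rightarrow> real \<Rightarrow> real) \<Rightarrow> bool" where
  "solves_linear_wave l \<sigma> P U \<longleftrightarrow>
     (\<forall>t. abs_continuous_on {0..l} (\<lambda>x. P x t) \<and> abs_continuous_on {0..l} (\<lambda>x. U x t)) \<and>
     (AE x in lebesgue. x \<in> {0<..<l} \<longrightarrow>
        (\<forall>t. \<exists>Px Pt Ux Ut.
           ((\<lambda>y. P y t) has_real_derivative Px) (at x) \<and>
           ((\<lambda>\<tau>. P x \<tau>) has_real_derivative Pt) (at t) \<and>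
           ((\<lambda>y. U y t) has_real_derivative Ux) (at x) \<and>
           ((\<lambda>\<tau>. U x \<tau>) has_real_derivative Ut) (at t) \<and>
           Px + Ut = 0 \<and> Ux + (\<sigma> x)\<^sup>2 * Pt = 0))"

definition reflect :: "(real \<Rightarrow> real) \<Rightarrow> real \<Rightarrow> real" where
  "reflect f t = f (- t)"

definition shift :: "real \<Rightarrow> (real \<Rightarrow> real) \<Rightarrow> real \<Rightarrow> real" where
  "shift \<tau> f t = f (t - \<tau>)"

definition odd_part :: "(real \<Rightarrow> real) \<Rightarrow> real \<Rightarrow> real" where
  "odd_part f t = (f t - reflect f t) / 2"

definition boundary_conditions ::
  "real \<Rightarrow> real \<Rightarrow> (real \<Rightarrow> real \<Rightarrow> real) \<Rightarrow> (real \<Rightarrow> real \<Rightarrow> real) \<Rightarrow> bool" where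
  "boundary_conditions l T P U \<longleftrightarrow>
     (\<forall>t. U 0 t = 0) \<and> (\<forall>t. P 0 (- t) = P 0 t) \<and>
     (\<forall>t. odd_part (shift (T / 4) (U l)) t = 0) \<and>
     (\<forall>t. odd_part (shift (T / 4) (P l)) t = 0)"

definition tone_P :: "real \<Rightarrow> (real \<Rightarrow> real) \<Rightarrow> real \<Rightarrow> real \<Rightarrow> real" where
  "tone_P w \<phi> x t = \<phi> x * cos (w * t)"

definition tone_U :: "real \<Rightarrow> (real \<Rightarrow> real) \<Rightarrow> real \<Rightarrow> real \<Rightarrow> real" where
  "tone_U w \<psi> x t = \<psi> x * sin (w * t)"

definition period :: "nat \<Rightarrow> real \<Rightarrow> real" where
  "period k w = 2 * pi * real k / w"

text \<open>Nontrivial solutions of - phi'' = lam sigma^2 phi (phi' absolutely continuous, equation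
  almost everywhere).  With w = sqrt lam and psi = - phi' / w, the boundary conditions are those
  which the separated functions phi cos (w t), psi sin (w t) have to satisfy; they involve k
  through the period.\<close>

definition SL_eigenfunction ::
  "real \<Rightarrow> (real \<Rightarrow> real) \<Rightarrow> nat \<Rightarrow> real \<Rightarrow> (real \<Rightarrow> real) \<Rightarrow> bool" where
  "SL_eigenfunction l \<sigma> k lam \<phi> \<longleftrightarrow>
     lam > 0 \<and> (\<exists>x\<in>{0..l}. \<phi> x \<noteq> 0) \<and>
     (\<exists>d\<phi>. (\<forall>x\<in>{0..l}. (\<phi> has_real_derivative d\<phi> x) (at x within {0..l})) \<and>
           abs_continuous_on {0..l} d\<phi> \<and>
           (AE x in lebesgue. x \<in> {0<..<l} \<longrightarrow>
              (\<exists>dd\<phi>. (d\<phi> has_real_derivative dd\<phi>) (at x) \<and> - dd\<phi> = lam * (\<sigma> x)\<^sup>2 * \<phi> x)) \<and>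
           boundary_conditions l (period k (sqrt lam))
             (tone_P (sqrt lam) \<phi>) (tone_U (sqrt lam) (\<lambda>x. - d\<phi> x / sqrt lam)))"

definition eigenfrequency :: "real \<Rightarrow> (real \<Rightarrow> real) \<Rightarrow> nat \<Rightarrow> real \<Rightarrow> bool" where
  "eigenfrequency l \<sigma> k w \<longleftrightarrow> (\<exists>lam \<phi>. SL_eigenfunction l \<sigma> k lam \<phi> \<and> w = sqrt lam)"

definition first_order_system ::
  "real \<Rightarrow> (real \<Rightarrow> real) \<Rightarrow> real \<Rightarrow> (real \<Rightarrow> real) \<Rightarrow> (real \<Rightarrow> real) \<Rightarrow> bool" where
  "first_order_system l \<sigma> w \<phi> \<psi> \<longleftrightarrow>
     abs_continuous_on {0..l} \<phi> \<and> abs_continuous_on {0..l} \<psi> \<and>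
     (AE x in lebesgue. x \<in> {0<..<l} \<longrightarrow>
        (\<exists>d\<phi> d\<psi>. (\<phi> has_real_derivative d\<phi>) (at x) \<and> (\<psi> has_real_derivative d\<psi>) (at x) \<and>
           d\<phi> + w * \<psi> x = 0 \<and> d\<psi> - (\<sigma> x)\<^sup>2 * w * \<phi> x = 0))"

end

theory Submission
  imports Defs
begin

text \<open>In polar coordinates \<open>\<phi> = r cos \<theta>\<close>, \<open>\<psi> = r sin \<theta>\<close> the first order system becomes the Pruefer
  equation \<open>\<theta>' = \<omega> (\<sigma>\<^sup>2 cos\<^sup>2 \<theta> + sin\<^sup>2 \<theta>)\<close> together with a quadrature for \<open>r\<close>.  With \<open>T = 2 \<pi> k / \<omega>\<close>,
  shifting by \<open>T/4\<close> turns the phase \<open>\<omega> t\<close> into \<open>\<omega> t - k \<pi> / 2\<close>, so the boundary conditions at \<open>l\<close> hold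
  once \<open>\<theta>(l) = k \<pi> / 2\<close>.  The angle \<open>\<theta>(l)\<close> is continuous and monotone in \<open>\<omega>\<close>, and it
  grows at least linearly because \<open>\<sigma>\<close> is bounded below; the intermediate value theorem
  gives \<open>\<omega>\<^sub>k = O(k)\<close>.

  Since \<open>log \<sigma>\<close> has bounded variation, \<open>\<sigma>\<close> agrees almost everywhere with a function that is continuous
  outside a countable set.  All differential equations can therefore be read pointwise off
  a countable set, and a continuous function with nonnegative derivative off a countable set is
  increasing, which replaces Lebesgue's differentiation theorem.\<close>

text \<open>If \<open>G\<close> decreased somewhere, some value outside the countable set \<open>G ` C\<close> would be
  taken for the last time at a point where the derivative is positive.\<close>

lemma deriv_pos_countable_imp_le:
  fixes G :: "real \<Rightarrow> real"
  assumes "a \<le> b" and cont: "continuous_on {a..b} G" and "countable C"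
    and deriv: "\<And>x. x \<in> {a..b} - C \<Longrightarrow> \<exists>d>0. (G has_real_derivative d) (at x)"
  shows "G a \<le> G b"
proof (rule ccontr)
  assume "\<not> G a \<le> G b"
  then have "uncountable {G b<..<G a}"
    by (simp add: uncountable_open_interval)
  moreover have "countable (G ` C)"
    using \<open>countable C\<close> by simp
  ultimately obtain y where y: "G b < y" "y < G a" "y \<notin> G ` C"
    by (metis countable_subset greaterThanLessThan_iff subsetI)
  define S where "S = {x \<in> {a..b}. G x = y}"
  have "S \<noteq> {}"
    using IVT2'[of G b y a] y assms(1) cont unfolding S_def by force
  moreover have "compact S"
  proof -
    have "closed S"
      unfolding S_def by (rule continuous_closed_preimage_constant[OF cont]) simp
    then show ?thesis
      unfolding S_def by (metis (no_types, lifting) S_def bounded_closed_interval bounded_subset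
          compact_eq_bounded_closed mem_Collect_eq subsetI)
  qed
  ultimately obtain x where x: "x \<in> S" and last: "\<And>z. z \<in> S \<Longrightarrow> z \<le> x"
    using compact_attains_sup[of S] by auto
  have xab: "x \<in> {a..b}" and Gx: "G x = y"
    using x by (auto simp: S_def)
  with y obtain d where "d > 0" "(G has_real_derivative d) (at x)"
    using deriv[of x] by blast
  then obtain e where e: "e > 0" "\<And>h. 0 < h \<Longrightarrow> h < e \<Longrightarrow> G x < G (x + h)"
    using DERIV_pos_inc_right by blast
  have "x < b"
    using xab Gx y by (cases "x = b") auto
  \<comment> \<open>\<open>G\<close> exceeds \<open>y\<close> at \<open>z\<close> but lies below
    \<open>y\<close> at \<open>b\<close>, so the value \<open>y\<close> recurs to the right of the
    supposedly last point \<open>x\<close>.\<close>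
  define z where "z = min (x + e / 2) b"
  have z: "x < z" "z \<le> b" "G x < G z"
    using \<open>x < b\<close> e(1) e(2)[of "z - x"] by (auto simp: z_def min_def split: if_splits)
  have "continuous_on {z..b} G"
    using cont by (rule continuous_on_subset) (use xab z in auto)
  then obtain w where "z \<le> w" "w \<le> b" "G w = y"
    using IVT2'[of G b y z] y z Gx by auto
  then show False
    using last[of w] z xab by (auto simp: S_def)
qed

text \<open>Adding \<open>k * x\<close> with a small \<open>k > 0\<close> makes the derivative
  strictly positive. The \<open>+ 1\<close> in the denominator of \<open>k\<close> covers the case
  \<open>a = b\<close>.\<close>

lemma deriv_nonneg_countable_imp_le:
  fixes F :: "real \<Rightarrow> real"
  assumes "a \<le> b" and cont: "continuous_on {a..b} F" and "countable C"
    and deriv: "\<And>x. x \<in> {a..b} - C \<Longrightarrow> \<exists>d\<ge>0. (F has_real_derivative d) (at x)"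
  shows "F a \<le> F b"
proof (rule field_le_epsilon)
  fix e :: real
  assume "e > 0"
  define k where "k = e / (b - a + 1)"
  have k: "k > 0" "k * (b - a) \<le> e"
    using \<open>e > 0\<close> \<open>a \<le> b\<close> by (auto simp: k_def field_simps)
  have "F a + k * a \<le> F b + k * b"
  proof (rule deriv_pos_countable_imp_le[OF \<open>a \<le> b\<close> _ \<open>countable C\<close>])
    fix x assume "x \<in> {a..b} - C"
    then obtain d where "d \<ge> 0" "(F has_real_derivative d) (at x)"
      using deriv by blast
    then show "\<exists>d>0. ((\<lambda>x. F x + k * x) has_real_derivative d) (at x)"
      using k by (intro exI[of _ "d + k"]) (auto intro!: derivative_eq_intros)
  qed (intro continuous_intros cont)
  then show "F a \<le> F b + e"
    using k by (simp add: algebra_simps)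
qed

subsection \<open>Bounded variation and absolute continuity\<close>

text \<open>\<open>V x\<close> is the total variation of \<open>g\<close> over
  \<open>{a..x}\<close>, the supremum of the variation sums in \<open>A x\<close>. A partition of
  \<open>{a..x}\<close> extended by the step from \<open>x\<close> to \<open>y\<close> competes in
  \<open>A y\<close>, which gives the inequality.\<close>

lemma finite_variation_on_majorant:
  fixes g :: "real \<Rightarrow> real"
  assumes "finite_variation_on {a..b} g"
  obtains V where "\<And>x y. a \<le> x \<Longrightarrow> x \<le> y \<Longrightarrow> y \<le> b \<Longrightarrow> \<bar>g y - g x\<bar> \<le> V y - V x"
proof -
  define part where "part x n p \<longleftrightarrow> (\<forall>i\<le>n. p i \<in> {a..x}) \<and> (\<forall>i<n. p i \<le> p (Suc i))"
    for x n and p :: "nat \<Rightarrow> real"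
  define vs where "vs n p = (\<Sum>i<n. \<bar>g (p (Suc i)) - g (p i)\<bar>)" for n p
  define A where "A x = {vs n p | n p. part x n p}" for x
  obtain K where K: "\<And>n p. part b n p \<Longrightarrow> vs n p \<le> K"
    using assms unfolding finite_variation_on_def part_def vs_def by blast
  have bdd: "bdd_above (A y)" if "y \<le> b" for y
  proof (rule bdd_aboveI)
    fix s assume "s \<in> A y"
    then obtain n p where "s = vs n p" "part y n p" by (auto simp: A_def)
    moreover from this have "part b n p" using that by (force simp: part_def)
    ultimately show "s \<le> K" using K by blast
  qed
  have "\<bar>g y - g x\<bar> \<le> Sup (A y) - Sup (A x)" if xy: "a \<le> x" "x \<le> y" "y \<le> b" for x y
  proof -
    have "Sup (A x) \<le> Sup (A y) - \<bar>g y - g x\<bar>"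
    proof (rule cSup_least)
      have "part x 0 (\<lambda>_. a)" using xy by (auto simp: part_def)
      then show "A x \<noteq> {}" by (auto simp: A_def)
    next
      fix s assume "s \<in> A x"
      then obtain n p where s: "s = vs n p" and p: "part x n p" by (auto simp: A_def)
      define q where "q i = (if i \<le> n then p i else if i = Suc n then x else y)" for i
      have "part y (Suc (Suc n)) q"
        using p xy by (force simp: part_def q_def le_Suc_eq less_Suc_eq)
      then have "vs (Suc (Suc n)) q \<le> Sup (A y)"
        using bdd[of y] xy by (auto simp: A_def intro!: cSup_upper)
      moreover have "(\<Sum>i<n. \<bar>g (q (Suc i)) - g (q i)\<bar>) = vs n p"
        unfolding vs_def by (rule sum.cong) (auto simp: q_def)
      ultimately show "s \<le> Sup (A y) - \<bar>g y - g x\<bar>"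
        by (simp add: s vs_def[of "Suc (Suc n)"] q_def)
    qed
    then show ?thesis by simp
  qed
  then show thesis by (rule that)
qed

lemma finite_variation_on_bounded:
  fixes g :: "real \<Rightarrow> real"
  assumes "finite_variation_on {a..b} g"
  obtains B where "\<And>x. x \<in> {a..b} \<Longrightarrow> \<bar>g x\<bar> \<le> B"
proof -
  obtain V where V: "\<And>x y. a \<le> x \<Longrightarrow> x \<le> y \<Longrightarrow> y \<le> b \<Longrightarrow> \<bar>g y - g x\<bar> \<le> V y - V x"
    using finite_variation_on_majorant[OF assms] by blast
  have "\<bar>g x\<bar> \<le> \<bar>g a\<bar> + (V b - V a)" if "x \<in> {a..b}" for x
    using V[of a x] V[of x b] that by (force simp: abs_le_iff)
  then show thesis by (rule that)
qed

text \<open>The majorant \<open>V\<close> is monotone, so it has countably many discontinuities, and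
  \<open>g\<close> inherits continuity from it at interior points. The endpoints join the
  exceptional set because \<open>isCont\<close> is two-sided.\<close>

lemma finite_variation_on_countable_discontinuities:
  fixes g :: "real \<Rightarrow> real"
  assumes "finite_variation_on {a..b} g"
  obtains C where "countable C" "\<And>x. x \<in> {a..b} - C \<Longrightarrow> isCont g x"
proof -
  obtain V where V: "\<And>x y. a \<le> x \<Longrightarrow> x \<le> y \<Longrightarrow> y \<le> b \<Longrightarrow> \<bar>g y - g x\<bar> \<le> V y - V x"
    using finite_variation_on_majorant[OF assms] by blast
  have "mono_on {a..b} V"
    using V by (force simp: mono_on_def)
  then have C: "countable {x \<in> {a..b}. \<not> continuous (at x within {a..b}) V}"
    by (rule mono_on_ctble_discont)
  have "isCont g x" if x: "x \<in> {a<..<b}" and c: "continuous (at x within {a..b}) V" for x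
  proof -
    have "isCont V x"
      using c x by (metis at_within_Icc_at greaterThanLessThan_iff)
    then have "((\<lambda>y. \<bar>V y - V x\<bar>) \<longlongrightarrow> 0) (at x)"
      by (simp add: isCont_def LIM_zero tendsto_rabs_zero)
    moreover have "\<forall>\<^sub>F y in at x. y \<in> {a<..<b}"
      using x by (intro eventually_at_in_open') auto
    then have "\<forall>\<^sub>F y in at x. norm (g y - g x) \<le> \<bar>V y - V x\<bar>"
    proof eventually_elim
      case (elim y)
      then show ?case
        using V[of x y] V[of y x] x by (cases "x \<le> y") force+
    qed
    ultimately have "((\<lambda>y. g y - g x) \<longlongrightarrow> 0) (at x)"
      by (rule Lim_null_comparison[rotated])
    then show ?thesis
      by (simp add: isCont_def LIM_zero_iff)
  qed
  then show thesis
    using C by (intro that[of "{x \<in> {a..b}. \<not> continuous (at x within {a..b}) V} \<union> {a, b}"]) auto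
qed

lemma Lipschitz_imp_abs_continuous_on:
  fixes f :: "real \<Rightarrow> real"
  assumes lip: "\<And>x y. x \<in> S \<Longrightarrow> y \<in> S \<Longrightarrow> x \<le> y \<Longrightarrow> \<bar>f y - f x\<bar> \<le> L * (y - x)"
  shows "abs_continuous_on S f"
  unfolding abs_continuous_on_def
proof (intro allI impI)
  fix e :: real
  assume "e > 0"
  \<comment> \<open>A positive Lipschitz constant, so that \<open>e / K\<close> can serve as
    \<open>d\<close>.\<close>
  define K where "K = \<bar>L\<bar> + 1"
  have "K > 0" by (simp add: K_def)
  show "\<exists>d>0. \<forall>n a b. (\<forall>i<n. a i \<in> S \<and> b i \<in> S \<and> a i \<le> b i) \<and>
      (\<forall>i. Suc i < n \<longrightarrow> b i \<le> a (Suc i)) \<and> (\<Sum>i<n. b i - a i) < d \<longrightarrow>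
      (\<Sum>i<n. \<bar>f (b i) - f (a i)\<bar>) < e"
  proof (intro exI[of _ "e / K"] conjI allI impI)
    fix n :: nat and a b :: "nat \<Rightarrow> real"
    assume *: "(\<forall>i<n. a i \<in> S \<and> b i \<in> S \<and> a i \<le> b i) \<and>
      (\<forall>i. Suc i < n \<longrightarrow> b i \<le> a (Suc i)) \<and> (\<Sum>i<n. b i - a i) < e / K"
    have "(\<Sum>i<n. \<bar>f (b i) - f (a i)\<bar>) \<le> (\<Sum>i<n. K * (b i - a i))"
    proof (rule sum_mono)
      fix i assume "i \<in> {..<n}"
      then have ab: "a i \<in> S" "b i \<in> S" "a i \<le> b i" using * by auto
      have "L * (b i - a i) \<le> K * (b i - a i)"
        using ab by (intro mult_right_mono) (auto simp: K_def)
      then show "\<bar>f (b i) - f (a i)\<bar> \<le> K * (b i - a i)"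
        using lip[OF ab] by linarith
    qed
    also have "\<dots> = K * (\<Sum>i<n. b i - a i)" by (simp add: sum_distrib_left)
    also have "\<dots> < e" using * \<open>K > 0\<close> by (simp add: field_simps)
    finally show "(\<Sum>i<n. \<bar>f (b i) - f (a i)\<bar>) < e" .
  qed (use \<open>e > 0\<close> \<open>K > 0\<close> in auto)
qed

subsection \<open>Primitives off a countable set\<close>

text \<open>\<open>C\<close> holds the points at which no derivative is claimed. With both endpoints
  in \<open>C\<close>, every remaining point is interior and derivatives there are
  two-sided.\<close>

locale rough_interval =
  fixes l :: real and C :: "real set"
  assumes l_pos: "0 < l" and countable_C: "countable C" and endpoints: "0 \<in> C" "l \<in> C"
begin

text \<open>The class of integrands: closed under the algebraic operations below, integrable, and
  with an indefinite integral differentiable off \<open>C\<close>.\<close>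

definition tame :: "(real \<Rightarrow> real) \<Rightarrow> bool" where
  "tame f \<longleftrightarrow> (\<exists>B. \<forall>x\<in>{0..l}. \<bar>f x\<bar> \<le> B) \<and> (\<forall>x\<in>{0..l} - C. isCont f x)"

text \<open>Continuity across \<open>C\<close> is what determines \<open>F\<close> up to a constant,
  although the derivative is prescribed only off the countable set.\<close>

definition primitive :: "(real \<Rightarrow> real) \<Rightarrow> (real \<Rightarrow> real) \<Rightarrow> bool" where
  "primitive f F \<longleftrightarrow> continuous_on {0..l} F \<and>
     (\<forall>x\<in>{0..l} - C. (F has_real_derivative f x) (at x))"

lemma off_C_interior: "x \<in> {0..l} - C \<Longrightarrow> x \<in> {0<..<l}"
  using endpoints by (cases "x = 0"; cases "x = l") auto

lemma tame_continuous:
  assumes "continuous_on {0..l} f"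
  shows "tame f"
proof -
  have "bounded (f ` {0..l})"
    using assms compact_continuous_image compact_imp_bounded by blast
  then have "\<exists>B. \<forall>x\<in>{0..l}. \<bar>f x\<bar> \<le> B"
    by (auto simp: bounded_iff)
  moreover have "isCont f x" if "x \<in> {0..l} - C" for x
    using continuous_on_interior[OF assms, of x] off_C_interior[OF that] by simp
  ultimately show ?thesis
    by (auto simp: tame_def)
qed

lemma tame_const: "tame (\<lambda>_. c)"
  by (rule tame_continuous) simp

lemma tame_add:
  assumes "tame f" "tame g"
  shows "tame (\<lambda>x. f x + g x)"
proof -
  obtain A B where "\<forall>x\<in>{0..l}. \<bar>f x\<bar> \<le> A" "\<forall>x\<in>{0..l}. \<bar>g x\<bar> \<le> B"
    using assms by (auto simp: tame_def)
  then have "\<forall>x\<in>{0..l}. \<bar>f x + g x\<bar> \<le> A + B"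
    by (meson abs_triangle_ineq add_mono order_trans)
  then show ?thesis
    using assms by (auto simp: tame_def)
qed

lemma tame_mult:
  assumes "tame f" "tame g"
  shows "tame (\<lambda>x. f x * g x)"
proof -
  obtain A B where "\<forall>x\<in>{0..l}. \<bar>f x\<bar> \<le> A" "\<forall>x\<in>{0..l}. \<bar>g x\<bar> \<le> B"
    using assms by (auto simp: tame_def)
  then have "\<forall>x\<in>{0..l}. \<bar>f x * g x\<bar> \<le> A * B"
    by (auto simp: abs_mult intro!: mult_mono order_trans[OF abs_ge_zero])
  then show ?thesis
    using assms by (auto simp: tame_def)
qed

lemma tame_diff:
  assumes "tame f" "tame g"
  shows "tame (\<lambda>x. f x - g x)"
  using tame_add[OF assms(1) tame_mult[OF tame_const[of "-1"] assms(2)]] by simp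

lemma primitiveD:
  assumes "primitive f F"
  shows "continuous_on {0..l} F"
    and "x \<in> {0..l} - C \<Longrightarrow> (F has_real_derivative f x) (at x)"
  using assms by (auto simp: primitive_def)

text \<open>Off the negligible set \<open>C\<close> the function is continuous, hence measurable,
  and it is bounded on a set of finite measure.\<close>

lemma tame_integrable:
  assumes "tame f"
  shows "f integrable_on {0..l}"
proof -
  obtain B where B: "\<forall>x\<in>{0..l}. \<bar>f x\<bar> \<le> B"
    using assms by (auto simp: tame_def)
  have neg: "negligible C"
    using countable_C by (simp add: negligible_iff_null_sets countable_imp_null_set_lborel null_sets_completionI)
  then have sets: "{0..l} - C \<in> sets lebesgue"
    by (intro sets.Diff) (auto simp: negligible_imp_sets)
  have "f integrable_on {0..l} - C"
  proof (rule measurable_bounded_by_integrable_imp_integrable[where g = "\<lambda>_. B"])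
    show "f \<in> borel_measurable (lebesgue_on ({0..l} - C))"
      using assms sets
      by (intro continuous_imp_measurable_on_sets_lebesgue continuous_at_imp_continuous_on)
        (auto simp: tame_def)
    have "(\<lambda>_. B) integrable_on {0..l}" by (rule integrable_const_ivl)
    then show "(\<lambda>_. B) integrable_on {0..l} - C"
      by (rule integrable_spike_set) (auto intro: negligible_subset[OF neg])
  qed (use B sets in auto)
  then show ?thesis
    by (rule integrable_spike_set) (auto intro: negligible_subset[OF neg])
qed

lemma tame_has_primitive:
  assumes "tame f"
  shows "primitive f (\<lambda>x. integral {0..x} f)"
  unfolding primitive_def
proof (intro conjI ballI)
  show "continuous_on {0..l} (\<lambda>x. integral {0..x} f)"
    by (rule indefinite_integral_continuous_1[OF tame_integrable[OF assms]])
  fix x assume x: "x \<in> {0..l} - C"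
  then have "isCont f x" using assms by (auto simp: tame_def)
  then have "((\<lambda>u. integral {0..u} f) has_vector_derivative f x) (at x within {0..l} - {})"
    using x by (intro integral_has_vector_derivative_continuous_at tame_integrable assms)
      (auto intro: continuous_at_imp_continuous_at_within)
  then show "((\<lambda>u. integral {0..u} f) has_real_derivative f x) (at x)"
    using off_C_interior[OF x] at_within_Icc_at[of 0 x l]
    by (simp add: has_real_derivative_iff_has_vector_derivative)
qed

text \<open>Both \<open>G - F\<close> and \<open>G + F\<close> have nonnegative derivative off
  \<open>C\<close>, hence increase. This takes the place of estimates under the integral
  sign.\<close>

lemma primitive_growth:
  assumes F: "primitive f F" and G: "primitive g G"
    and "0 \<le> x" "x \<le> y" "y \<le> l" and le: "\<And>z. z \<in> {0..l} - C \<Longrightarrow> \<bar>f z\<bar> \<le> g z"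
  shows "\<bar>F y - F x\<bar> \<le> G y - G x"
proof -
  have sub: "{x..y} \<subseteq> {0..l}" using assms by auto
  note cont = continuous_on_subset[OF primitiveD(1)[OF F] sub]
    continuous_on_subset[OF primitiveD(1)[OF G] sub]
  have "G x - F x \<le> G y - F y"
  proof (rule deriv_nonneg_countable_imp_le[OF \<open>x \<le> y\<close> _ countable_C])
    fix z assume "z \<in> {x..y} - C"
    then have "z \<in> {0..l} - C" using sub by auto
    then show "\<exists>d\<ge>0. ((\<lambda>z. G z - F z) has_real_derivative d) (at z)"
      using le[of z] by (intro exI[of _ "g z - f z"])
        (auto intro!: derivative_intros primitiveD(2)[OF F] primitiveD(2)[OF G])
  qed (intro continuous_intros cont)
  moreover have "G x + F x \<le> G y + F y"
  proof (rule deriv_nonneg_countable_imp_le[OF \<open>x \<le> y\<close> _ countable_C])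
    fix z assume "z \<in> {x..y} - C"
    then have "z \<in> {0..l} - C" using sub by auto
    then show "\<exists>d\<ge>0. ((\<lambda>z. G z + F z) has_real_derivative d) (at z)"
      using le[of z] by (intro exI[of _ "g z + f z"])
        (auto intro!: derivative_intros primitiveD(2)[OF F] primitiveD(2)[OF G])
  qed (intro continuous_intros cont)
  ultimately show ?thesis by linarith
qed

lemma primitive_linear: "primitive (\<lambda>_. c) (\<lambda>x. c * x)"
  unfolding primitive_def by (auto intro!: continuous_intros derivative_eq_intros)

lemma primitive_diff:
  "primitive f F \<Longrightarrow> primitive g G \<Longrightarrow> primitive (\<lambda>x. f x - g x) (\<lambda>x. F x - G x)"
  unfolding primitive_def by (auto intro!: continuous_intros derivative_intros)

lemma primitive_mult_const: "primitive f F \<Longrightarrow> primitive (\<lambda>x. f x * c) (\<lambda>x. F x * c)"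
  unfolding primitive_def by (auto intro!: continuous_intros DERIV_cmult_right)

lemma primitive_Lipschitz:
  assumes "primitive f F" "0 \<le> x" "x \<le> y" "y \<le> l" "\<And>z. z \<in> {0..l} - C \<Longrightarrow> \<bar>f z\<bar> \<le> B"
  shows "\<bar>F y - F x\<bar> \<le> B * (y - x)"
  using primitive_growth[OF assms(1) primitive_linear assms(2-5)] by (simp add: algebra_simps)

lemma primitive_unique:
  assumes "primitive f F" "primitive f G" "x \<in> {0..l}" "F 0 = G 0"
  shows "F x = G x"
  using primitive_Lipschitz[OF primitive_diff[OF assms(1,2)], of 0 x 0] assms(3,4) by simp

lemma tame_primitive_abs_continuous:
  assumes "tame f" "primitive f F"
  shows "abs_continuous_on {0..l} F"
proof -
  obtain B where "\<forall>x\<in>{0..l}. \<bar>f x\<bar> \<le> B"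
    using assms(1) by (auto simp: tame_def)
  then show ?thesis
    by (intro Lipschitz_imp_abs_continuous_on[where L = B] primitive_Lipschitz[OF assms(2)]) auto
qed

text \<open>By uniqueness \<open>F\<close> is a constant plus the integral of \<open>f\<close>, and
  continuity of \<open>f\<close> makes that integral differentiable on all of \<open>{0..l}\<close>,
  also at points of \<open>C\<close>. \<open>SL_eigenfunction\<close> asks for this at every
  point.\<close>

lemma primitive_continuous_deriv:
  assumes "primitive f F" and f: "continuous_on {0..l} f" and x: "x \<in> {0..l}"
  shows "(F has_real_derivative f x) (at x within {0..l})"
proof -
  let ?G = "\<lambda>x. F 0 + integral {0..x} f"
  have "((\<lambda>x. integral {0..x} f) has_vector_derivative f x) (at x within {0..l})"
    using integral_has_vector_derivative[OF f x] .
  then have G: "(?G has_real_derivative f x) (at x within {0..l})"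
    by (auto simp: has_real_derivative_iff_has_vector_derivative intro!: derivative_eq_intros)
  have "primitive f ?G"
    using tame_has_primitive[OF tame_continuous[OF f]]
    by (auto simp: primitive_def intro!: continuous_intros derivative_eq_intros)
  then have "?G y = F y" if "y \<in> {0..l}" for y
    using primitive_unique[OF _ assms(1) that] by simp
  then show ?thesis
    by (rule has_field_derivative_transform_within[OF G zero_less_one x])
qed

end

subsection \<open>The Pruefer angle\<close>

text \<open>Writes \<open>sin D\<close> as a bounded continuous factor times \<open>D\<close>, so
  that the equation for a difference \<open>D\<close> of two angles becomes linear.\<close>

definition sinc :: "real \<Rightarrow> real" where
  "sinc x = (if x = 0 then 1 else sin x / x)"

lemma sinc_mult: "sinc x * x = sin x"
  by (simp add: sinc_def)

lemma abs_sinc_le_1: "\<bar>sinc x\<bar> \<le> 1"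
  using abs_sin_x_le_abs_x[of x] by (simp add: sinc_def divide_le_eq)

lemma isCont_sinc: "isCont sinc x"
proof (cases "x = 0")
  case True
  have "(\<lambda>h. sin h / h) \<midarrow>0\<rightarrow> (1::real)"
    using DERIV_sin[of "0::real"] by (simp add: DERIV_def)
  then have "sinc \<midarrow>0\<rightarrow> 1"
    by (rule Lim_transform_eventually) (auto simp: sinc_def eventually_at_filter)
  then show ?thesis
    using True by (simp add: isCont_def sinc_def)
next
  case False
  have "isCont (\<lambda>x. sin x / x) x"
    using False by (intro continuous_intros) auto
  moreover have "\<forall>\<^sub>F y in nhds x. sinc y = sin y / y"
    using False by (intro eventually_mono[OF t1_space_nhds[of x 0]]) (auto simp: sinc_def)
  ultimately show ?thesis
    by (simp add: isCont_cong)
qed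

lemma continuous_on_sinc: "continuous_on S f \<Longrightarrow> continuous_on S (\<lambda>x. sinc (f x))"
  by (rule continuous_on_compose2[of UNIV sinc])
    (auto intro: continuous_at_imp_continuous_on isCont_sinc)

text \<open>\<open>h\<close> stands for a representative of \<open>\<sigma>\<^sup>2\<close>, bounded
  away from zero and continuous off \<open>C\<close>.\<close>

locale weight = rough_interval +
  fixes h :: "real \<Rightarrow> real" and m M :: real
  assumes m_pos: "0 < m" and h_bounds: "x \<in> {0..l} \<Longrightarrow> m \<le> h x \<and> h x \<le> M"
    and h_cont: "x \<in> {0..l} - C \<Longrightarrow> isCont h x"
begin

lemma tame_h: "tame h"
proof -
  have "\<bar>h x\<bar> \<le> M" if "x \<in> {0..l}" for x
    using h_bounds[OF that] m_pos by simp
  then show ?thesis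
    unfolding tame_def using h_cont by blast
qed

lemma M_pos: "0 < M"
  using h_bounds[of 0] m_pos l_pos by auto

definition slope :: "real \<Rightarrow> real \<Rightarrow> real" where
  "slope x a = h x * (cos a)\<^sup>2 + (sin a)\<^sup>2"

text \<open>Since \<open>slope x a\<close> equals \<open>h x + (1 - h x) * (sin a)\<^sup>2\<close>,
  only the identity for a difference of squared sines is involved.\<close>

lemma slope_diff: "slope x a - slope x b = (1 - h x) * sin (a + b) * sin (a - b)"
proof -
  have "sin (a + b) * sin (a - b) = (sin a)\<^sup>2 * (cos b)\<^sup>2 - (cos a)\<^sup>2 * (sin b)\<^sup>2"
    by (simp add: sin_add sin_diff algebra_simps power2_eq_square)
  also have "\<dots> = (sin a)\<^sup>2 - (sin b)\<^sup>2"
    by (simp add: cos_squared_eq algebra_simps)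
  finally show ?thesis
    by (simp add: slope_def cos_squared_eq mult.assoc) (simp add: algebra_simps)
qed

lemma abs_1_minus_h_le: "x \<in> {0..l} \<Longrightarrow> \<bar>1 - h x\<bar> \<le> 1 + M"
  using h_bounds[of x] m_pos by auto

lemma slope_Lipschitz:
  assumes "x \<in> {0..l}"
  shows "\<bar>slope x a - slope x b\<bar> \<le> (1 + M) * \<bar>a - b\<bar>"
proof -
  have "\<bar>slope x a - slope x b\<bar> = \<bar>1 - h x\<bar> * (\<bar>sin (a + b)\<bar> * \<bar>sin (a - b)\<bar>)"
    by (simp add: slope_diff abs_mult)
  also have "\<dots> \<le> (1 + M) * (1 * \<bar>a - b\<bar>)"
    using M_pos abs_1_minus_h_le[OF assms]
    by (intro mult_mono abs_sin_x_le_abs_x) auto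
  finally show ?thesis by simp
qed

text \<open>The weights \<open>(cos a)\<^sup>2\<close> and \<open>(sin a)\<^sup>2\<close> make the
  slope a convex combination of \<open>h x\<close> and \<open>1\<close>.\<close>

lemma slope_bounds:
  assumes "x \<in> {0..l}"
  shows "min m 1 \<le> slope x a" "slope x a \<le> 1 + M"
proof -
  have "min m 1 * (cos a)\<^sup>2 + min m 1 * (sin a)\<^sup>2 \<le> slope x a"
    unfolding slope_def using h_bounds[OF assms]
    by (intro add_mono mult_right_mono mult_left_le_one_le) (auto simp: m_pos less_imp_le)
  then show "min m 1 \<le> slope x a"
    by (simp flip: distrib_left)
  have "h x * (cos a)\<^sup>2 \<le> M * 1"
    using h_bounds[OF assms] M_pos by (intro mult_mono) (auto simp: abs_square_le_1)
  moreover have "(sin a)\<^sup>2 \<le> 1"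
    by (simp add: abs_square_le_1)
  ultimately show "slope x a \<le> 1 + M"
    by (simp add: slope_def)
qed

lemma abs_slope_le: "x \<in> {0..l} \<Longrightarrow> \<bar>slope x a\<bar> \<le> 1 + M"
  using slope_bounds[of x a] m_pos by auto

lemma tame_slope:
  assumes "continuous_on {0..l} \<theta>"
  shows "tame (\<lambda>x. slope x (\<theta> x))"
  unfolding slope_def
  by (intro tame_add tame_mult tame_h tame_continuous continuous_intros assms)

section \<open>Existence of the Pruefer angle\<close>

definition is_angle :: "real \<Rightarrow> (real \<Rightarrow> real) \<Rightarrow> bool" where
  "is_angle w \<theta> \<longleftrightarrow> primitive (\<lambda>x. w * slope x (\<theta> x)) \<theta> \<and> \<theta> 0 = 0"

text \<open>Picard iteration from the zero function: the right-hand side is Lipschitz in the angle,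
  the increments of the iterates decay geometrically, and the uniform limit is a fixed point of
  \<open>T\<close>.\<close>

lemma is_angle_exists:
  assumes "0 \<le> w"
  shows "\<exists>\<theta>. is_angle w \<theta>"
proof -
  define T where "T \<theta> = (\<lambda>x. integral {0..x} (\<lambda>y. w * slope y (\<theta> y)))" for \<theta>
  have T_prim: "primitive (\<lambda>x. w * slope x (\<theta> x)) (T \<theta>)" if "continuous_on {0..l} \<theta>" for \<theta>
    unfolding T_def by (intro tame_has_primitive tame_mult tame_const tame_slope that)
  have T_0: "T \<theta> 0 = 0" for \<theta>
    by (simp add: T_def)
  define th where "th n = (T ^^ n) (\<lambda>_. 0)" for n
  have th_Suc: "th (Suc n) = T (th n)" and th_0: "th 0 = (\<lambda>_. 0)" for n
    by (simp_all add: th_def)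
  have th_cont: "continuous_on {0..l} (th n)" for n
    by (induction n) (auto simp: th_0 th_Suc intro: primitiveD(1) T_prim)
  \<comment> \<open>Bounds both the size and the Lipschitz constant of the right-hand side; the
    \<open>+ 1\<close> keeps it positive when \<open>w = 0\<close>.\<close>
  define K where "K = w * (1 + M) + 1"
  have K: "K > 0" "w * (1 + M) \<le> K"
    using assms M_pos by (auto simp: K_def add_nonneg_pos)
  have w_slope_diff: "\<bar>w * slope x a - w * slope x b\<bar> \<le> K * \<bar>a - b\<bar>" if "x \<in> {0..l}" for x a b
  proof -
    have "\<bar>w * slope x a - w * slope x b\<bar> = w * \<bar>slope x a - slope x b\<bar>"
      using assms by (simp add: abs_mult flip: right_diff_distrib)
    also have "\<dots> \<le> w * ((1 + M) * \<bar>a - b\<bar>)"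
      using assms slope_Lipschitz[OF that] by (intro mult_left_mono)
    also have "\<dots> \<le> K * \<bar>a - b\<bar>"
      using K(2) by (simp add: mult_right_mono flip: mult.assoc)
    finally show ?thesis .
  qed
  \<comment> \<open>The weight \<open>exp (2 * K * x)\<close> makes \<open>T\<close> a contraction with factor one half.\<close>
  have step: "\<bar>th (Suc n) x - th n x\<bar> \<le> K * l * (1/2) ^ n * exp (2 * K * x)"
    if "x \<in> {0..l}" for n x
    using that
  proof (induction n arbitrary: x)
    case 0
    have "\<bar>th 1 x - th 1 0\<bar> \<le> K * (x - 0)"
      unfolding One_nat_def th_Suc
    proof (rule primitive_Lipschitz[OF T_prim[OF th_cont]])
      fix z assume "z \<in> {0..l} - C"
      then have "w * \<bar>slope z (th 0 z)\<bar> \<le> w * (1 + M)"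
        using assms abs_slope_le by (intro mult_left_mono) auto
      then show "\<bar>w * slope z (th 0 z)\<bar> \<le> K"
        using K(2) assms by (simp add: abs_mult)
    qed (use 0 in auto)
    moreover have "K * x \<le> K * l * exp (2 * K * x)"
    proof -
      have "K * x * 1 \<le> K * l * exp (2 * K * x)"
        using 0 K(1) by (intro mult_mono) auto
      then show ?thesis by simp
    qed
    ultimately show ?case
      by (simp add: th_Suc th_0 T_0)
  next
    case (Suc n)
    \<comment> \<open>The bound claimed for \<open>Suc n\<close> is a primitive of \<open>K\<close>
      times the bound for \<open>n\<close>, so \<open>primitive_growth\<close> carries the
      induction.\<close>
    let ?G = "\<lambda>x. K * l * (1/2) ^ Suc n * exp (2 * K * x)"
    have G: "primitive (\<lambda>x. K * (K * l * (1/2) ^ n * exp (2 * K * x))) ?G"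
      unfolding primitive_def
      by (auto intro!: continuous_intros derivative_eq_intros)
    have "\<bar>(th (Suc (Suc n)) x - th (Suc n) x) - (th (Suc (Suc n)) 0 - th (Suc n) 0)\<bar> \<le> ?G x - ?G 0"
      unfolding th_Suc[of "Suc n"] th_Suc[of n]
    proof (rule primitive_growth[OF primitive_diff[OF T_prim T_prim] G])
      fix z assume z: "z \<in> {0..l} - C"
      have "\<bar>w * slope z (T (th n) z) - w * slope z (th n z)\<bar> \<le> K * \<bar>T (th n) z - th n z\<bar>"
        using z by (intro w_slope_diff) auto
      also have "\<dots> \<le> K * (K * l * (1/2) ^ n * exp (2 * K * z))"
        using Suc.IH[of z] z K(1) by (intro mult_left_mono) (auto simp: th_Suc)
      finally show "\<bar>w * slope z (T (th n) z) - w * slope z (th n z)\<bar> \<le> \<dots>" .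
    qed (use Suc.prems th_cont[of n] th_cont[of "Suc n"] in \<open>auto simp: th_Suc\<close>)
    moreover have "0 \<le> ?G 0"
      using K(1) l_pos by simp
    ultimately show ?case
      by (simp add: th_Suc T_0)
  qed
  \<comment> \<open>The partial sums telescope to \<open>th n\<close> because \<open>th 0\<close>
    vanishes, so the M-test yields uniform convergence of the iterates.\<close>
  define \<theta> where "\<theta> x = (\<Sum>i. th (Suc i) x - th i x)" for x
  have "uniform_limit {0..l} (\<lambda>n x. \<Sum>i<n. th (Suc i) x - th i x) \<theta> sequentially"
    unfolding \<theta>_def
  proof (rule Weierstrass_m_test)
    fix n x assume x: "x \<in> {0..l}"
    have "K * l * (1/2) ^ n * exp (2 * K * x) \<le> K * l * (1/2) ^ n * exp (2 * K * l)"
      using x K(1) by (intro mult_left_mono) auto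
    then show "norm (th (Suc n) x - th n x) \<le> K * l * exp (2 * K * l) * (1/2) ^ n"
      using step[OF x, of n] by (simp add: mult_ac)
  qed (intro summable_mult summable_geometric, simp)
  moreover have "(\<lambda>n x. \<Sum>i<n. th (Suc i) x - th i x) = th"
  proof (intro ext)
    show "(\<Sum>i<n. th (Suc i) x - th i x) = th n x" for n x
      using sum_lessThan_telescope[of "\<lambda>i. th i x" n] by (simp add: th_0)
  qed
  ultimately have lim: "uniform_limit {0..l} th \<theta> sequentially"
    by simp
  have \<theta>_cont: "continuous_on {0..l} \<theta>"
    by (rule uniform_limit_theorem[OF _ lim]) (auto simp: th_cont)
  have fixpoint: "T \<theta> x = \<theta> x" if x: "x \<in> {0..l}" for x
  proof -
    have "(\<lambda>n. th (Suc n) x) \<longlonglongrightarrow> T \<theta> x"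
    proof (rule LIMSEQ_I)
      fix e :: real assume "e > 0"
      \<comment> \<open>A uniform error \<open>d\<close> in the argument of \<open>T\<close> changes
        its value by at most \<open>K * d * l\<close>, which is less than \<open>e\<close>.\<close>
      define d where "d = e / (K * l + 1)"
      have "K * l + 1 > 0" using K(1) l_pos by (simp add: add_nonneg_pos)
      then have d: "d > 0" "K * d * l < e"
        using \<open>e > 0\<close> by (auto simp: d_def field_simps)
      then obtain N where N: "\<And>n z. n \<ge> N \<Longrightarrow> z \<in> {0..l} \<Longrightarrow> \<bar>th n z - \<theta> z\<bar> < d"
        using lim unfolding uniform_limit_iff eventually_sequentially dist_real_def by metis
      have "norm (th (Suc n) x - T \<theta> x) < e" if "n \<ge> N" for n
      proof -
        have "\<bar>(T (th n) x - T \<theta> x) - (T (th n) 0 - T \<theta> 0)\<bar> \<le> K * d * (x - 0)"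
        proof (rule primitive_Lipschitz[OF primitive_diff[OF T_prim T_prim]])
          fix z assume z: "z \<in> {0..l} - C"
          have "\<bar>w * slope z (th n z) - w * slope z (\<theta> z)\<bar> \<le> K * \<bar>th n z - \<theta> z\<bar>"
            using z by (intro w_slope_diff) auto
          also have "\<dots> \<le> K * d"
            using N[OF that, of z] z K(1) by (intro mult_left_mono) auto
          finally show "\<bar>w * slope z (th n z) - w * slope z (\<theta> z)\<bar> \<le> K * d" .
        qed (use x th_cont \<theta>_cont in auto)
        moreover have "K * d * x \<le> K * d * l"
          using x K(1) d by (intro mult_left_mono) auto
        ultimately show ?thesis
          using d by (simp add: th_Suc T_0)
      qed
      then show "\<exists>N. \<forall>n\<ge>N. norm (th (Suc n) x - T \<theta> x) < e" by blast
    qed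
    moreover have "(\<lambda>n. th (Suc n) x) \<longlonglongrightarrow> \<theta> x"
      using tendsto_uniform_limitI[OF lim x] by (rule LIMSEQ_Suc)
    ultimately show ?thesis
      by (rule LIMSEQ_unique)
  qed
  \<comment> \<open>\<open>T \<theta>\<close> is a primitive by construction;
    \<open>fixpoint\<close> rewrites its derivative into the required form.\<close>
  have "is_angle w (T \<theta>)"
    using T_prim[OF \<theta>_cont] fixpoint T_0 by (auto simp: is_angle_def primitive_def)
  then show ?thesis by blast
qed

section \<open>Dependence of the angle on the frequency\<close>

text \<open>The integrating factor \<open>exp (- Q x)\<close> turns the linear equation for the
  difference into a quadrature whose integrand is nonnegative and at most a multiple of
  \<open>w2 - w1\<close>.\<close>

lemma angle_comparison:
  assumes a1: "is_angle w1 \<theta>1" and a2: "is_angle w2 \<theta>2" and w: "0 \<le> w1" "w1 \<le> w2"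
  shows "0 \<le> \<theta>2 l - \<theta>1 l"
    and "\<theta>2 l - \<theta>1 l \<le> exp (2 * w1 * (1 + M) * l) * (1 + M) * l * (w2 - w1)"
proof -
  note p1 = conjunct1[OF a1[unfolded is_angle_def]]
  note p2 = conjunct1[OF a2[unfolded is_angle_def]]
  note cont = primitiveD(1)[OF p1] primitiveD(1)[OF p2]
  define D where "D x = \<theta>2 x - \<theta>1 x" for x
  \<comment> \<open>The equation for \<open>D\<close> is linear, \<open>D' = (w2 - w1) * slope x (\<theta>2 x) + q * D\<close>.\<close>
  define q where "q x = w1 * ((1 - h x) * sin (\<theta>2 x + \<theta>1 x) * sinc (D x))" for x
  have D_cont: "continuous_on {0..l} D"
    unfolding D_def by (intro continuous_intros cont)
  have "tame q"
    unfolding q_def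
    by (intro tame_mult tame_diff tame_const tame_h tame_continuous continuous_intros
        continuous_on_sinc cont D_cont)
  then obtain Q where Q: "primitive q Q" "Q 0 = 0"
    using tame_has_primitive by force
  define R where "R = w1 * (1 + M) * l"
  have Q_le: "\<bar>Q x\<bar> \<le> R" if "x \<in> {0..l}" for x
  proof -
    have "\<bar>Q x - Q 0\<bar> \<le> (w1 * (1 + M)) * (x - 0)"
    proof (rule primitive_Lipschitz[OF Q(1)])
      fix z assume "z \<in> {0..l} - C"
      then have "\<bar>1 - h z\<bar> * \<bar>sin (\<theta>2 z + \<theta>1 z)\<bar> * \<bar>sinc (D z)\<bar> \<le> (1 + M) * 1 * 1"
        using M_pos by (intro mult_mono abs_1_minus_h_le abs_sinc_le_1) auto
      then show "\<bar>q z\<bar> \<le> w1 * (1 + M)"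
        using w by (simp add: q_def abs_mult mult_left_mono)
    qed (use that in auto)
    also have "\<dots> \<le> R"
      unfolding R_def using that w M_pos by (intro mult_left_mono) auto
    finally show ?thesis using Q(2) by simp
  qed
  define E where "E x = exp (- Q x) * D x" for x
  define f where "f x = exp (- Q x) * ((w2 - w1) * slope x (\<theta>2 x))" for x
  have E: "primitive f E"
    unfolding primitive_def
  proof (intro conjI ballI)
    show "continuous_on {0..l} E"
      unfolding E_def by (intro continuous_intros D_cont primitiveD(1)[OF Q(1)])
    fix x assume x: "x \<in> {0..l} - C"
    \<comment> \<open>Exact by \<open>slope_diff\<close> and \<open>sinc_mult\<close>; subtracting
      it from the derivative of \<open>D\<close> leaves
      \<open>(w2 - w1) * slope x (\<theta>2 x)\<close>.\<close>
    have q: "q x * D x = w1 * (slope x (\<theta>2 x) - slope x (\<theta>1 x))"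
      unfolding slope_diff by (simp add: q_def mult.assoc sinc_mult) (simp add: D_def)
    have "(E has_real_derivative exp (- Q x) * (- q x) * D x
        + (w2 * slope x (\<theta>2 x) - w1 * slope x (\<theta>1 x)) * exp (- Q x)) (at x)"
      unfolding E_def D_def
      by (auto intro!: derivative_eq_intros primitiveD(2)[OF Q(1) x] primitiveD(2)[OF p1 x]
          primitiveD(2)[OF p2 x])
    also have "exp (- Q x) * (- q x) * D x
        + (w2 * slope x (\<theta>2 x) - w1 * slope x (\<theta>1 x)) * exp (- Q x)
      = exp (- Q x) * (w2 * slope x (\<theta>2 x) - w1 * slope x (\<theta>1 x) - q x * D x)"
      by (simp add: algebra_simps)
    also have "\<dots> = f x"
      unfolding q f_def by (simp add: algebra_simps)
    finally show "(E has_real_derivative f x) (at x)" .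
  qed
  have E0: "E 0 = 0"
    using a1 a2 by (simp add: E_def D_def is_angle_def)
  have f_nonneg: "0 \<le> f x" and f_le: "f x \<le> exp R * ((w2 - w1) * (1 + M))" if "x \<in> {0..l}" for x
    using slope_bounds[OF that, of "\<theta>2 x"] m_pos w Q_le[OF that] unfolding f_def
    by (auto intro!: mult_nonneg_nonneg mult_mono)
  have "\<bar>E l - E 0\<bar> \<le> E l - E 0"
    using l_pos f_nonneg by (intro primitive_growth[OF E E]) auto
  then have "0 \<le> E l"
    using E0 by simp
  then show "0 \<le> \<theta>2 l - \<theta>1 l"
    by (simp add: E_def D_def zero_le_mult_iff)
  have "\<bar>E l - E 0\<bar> \<le> exp R * ((w2 - w1) * (1 + M)) * (l - 0)"
    using l_pos f_nonneg f_le by (intro primitive_Lipschitz[OF E]) auto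
  then have E_le: "E l \<le> exp R * ((w2 - w1) * (1 + M)) * l"
    using E0 by simp
  \<comment> \<open>Undoing the integrating factor costs a second \<open>exp R\<close>, hence the
    \<open>2\<close> in the exponent of the claim.\<close>
  have "D l = exp (Q l) * E l"
    by (simp add: E_def mult.assoc[symmetric] flip: exp_add)
  also have "\<dots> \<le> exp R * (exp R * ((w2 - w1) * (1 + M)) * l)"
    using E_le Q_le[of l] l_pos \<open>0 \<le> E l\<close> by (intro mult_mono) auto
  also have "\<dots> = (exp R * exp R) * (1 + M) * l * (w2 - w1)"
    by (simp add: algebra_simps)
  also have "exp R * exp R = exp (2 * w1 * (1 + M) * l)"
    by (simp add: R_def algebra_simps flip: exp_add)
  finally show "\<theta>2 l - \<theta>1 l \<le> exp (2 * w1 * (1 + M) * l) * (1 + M) * l * (w2 - w1)"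
    by (simp add: D_def)
qed

lemma angle_lower_bound:
  assumes a: "is_angle w \<theta>" and "0 \<le> w"
  shows "w * min m 1 * l \<le> \<theta> l"
proof -
  have "\<bar>w * min m 1 * l - w * min m 1 * 0\<bar> \<le> \<theta> l - \<theta> 0"
  proof (rule primitive_growth[OF primitive_linear conjunct1[OF a[unfolded is_angle_def]]])
    fix z assume "z \<in> {0..l} - C"
    then have "w * min m 1 \<le> w * slope z (\<theta> z)"
      using assms slope_bounds by (intro mult_left_mono) auto
    then show "\<bar>w * min m 1\<bar> \<le> w * slope z (\<theta> z)"
      using \<open>0 \<le> w\<close> m_pos by (simp add: abs_mult)
  qed (use l_pos in auto)
  then show ?thesis
    using a by (simp add: is_angle_def)
qed

text \<open>The choice does not affect the value at \<open>l\<close>: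
  \<open>angle_comparison\<close> with equal frequencies shows that all solutions agree
  there.\<close>

definition angle :: "real \<Rightarrow> real \<Rightarrow> real" where
  "angle w = (SOME \<theta>. is_angle w \<theta>)"

lemma is_angle_angle: "0 \<le> w \<Longrightarrow> is_angle w (angle w)"
  unfolding angle_def by (rule someI_ex[OF is_angle_exists])

lemma angle_mono: "0 \<le> w1 \<Longrightarrow> w1 \<le> w2 \<Longrightarrow> angle w1 l \<le> angle w2 l"
  using angle_comparison(1)[OF is_angle_angle is_angle_angle] by simp

text \<open>The Lipschitz constant from \<open>angle_comparison\<close> grows with the frequency, so
  its value at \<open>W\<close> serves on all of \<open>{0..W}\<close>.\<close>

lemma angle_continuous: "continuous_on {0..W} (\<lambda>w. angle w l)"
proof -
  define L where "L = exp (2 * W * (1 + M) * l) * (1 + M) * l"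
  have le: "\<bar>angle w2 l - angle w1 l\<bar> \<le> L * \<bar>w2 - w1\<bar>" if "0 \<le> w1" "w1 \<le> w2" "w2 \<le> W" for w1 w2
  proof -
    have "\<bar>angle w2 l - angle w1 l\<bar>
        \<le> exp (2 * w1 * (1 + M) * l) * (1 + M) * l * (w2 - w1)"
      using angle_comparison[OF is_angle_angle is_angle_angle, of w1 w2] that by simp
    also have "\<dots> \<le> L * (w2 - w1)"
      unfolding L_def using that M_pos l_pos by (intro mult_right_mono) auto
    finally show ?thesis using that by simp
  qed
  have "L-lipschitz_on {0..W} (\<lambda>w. angle w l)"
  proof (rule lipschitz_onI)
    show "0 \<le> L" using M_pos l_pos by (simp add: L_def)
    show "dist (angle w1 l) (angle w2 l) \<le> L * dist w1 w2"
      if "w1 \<in> {0..W}" "w2 \<in> {0..W}" for w1 w2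
      using le[of w1 w2] le[of w2 w1] that
      by (cases "w1 \<le> w2") (auto simp: dist_real_def abs_minus_commute)
  qed
  then show ?thesis by (rule lipschitz_on_continuous_on)
qed

text \<open>Intermediate value theorem on \<open>{0..W}\<close>: the angle at \<open>l\<close> is
  zero for \<open>w = 0\<close>, and \<open>W\<close> is chosen so that
  \<open>angle_lower_bound\<close> reaches exactly \<open>a\<close>. The bound
  \<open>w \<le> W\<close> later controls \<open>\<omega> k / real k\<close>.\<close>

lemma frequency_exists:
  assumes "0 < a"
  shows "\<exists>w. 0 < w \<and> w \<le> a / (min m 1 * l) \<and> angle w l = a"
proof -
  have c: "0 < min m 1 * l" using m_pos l_pos by simp
  define W where "W = a / (min m 1 * l)"
  have W: "0 \<le> W" "W * min m 1 * l = a"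
    using c assms unfolding W_def by (auto simp: mult.assoc)
  have "angle 0 l - angle 0 0 = 0"
    using primitive_Lipschitz[of _ "angle 0" 0 l 0] is_angle_angle[of 0] l_pos
    by (force simp: is_angle_def)
  then have "angle 0 l = 0"
    using is_angle_angle[of 0] by (simp add: is_angle_def)
  moreover have "a \<le> angle W l"
    using angle_lower_bound[OF is_angle_angle, of W] W by simp
  ultimately obtain w where "0 \<le> w" "w \<le> W" "angle w l = a"
    using IVT'[of "\<lambda>w. angle w l" 0 a W] assms W angle_continuous by auto
  moreover from this have "w \<noteq> 0"
    using \<open>angle 0 l = 0\<close> assms by auto
  ultimately show ?thesis
    unfolding W_def by (intro exI[of _ w]) auto
qed

section \<open>Eigenfunctions from the angle\<close>

text \<open>Inverts the Pruefer substitution with radius \<open>exp (R x)\<close>; the derivatives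
  collapse to the first order system because the squares of sine and cosine sum to one.\<close>

lemma eigenfunctions_exist:
  assumes a: "is_angle w \<theta>"
  obtains \<phi> \<psi> r where "primitive (\<lambda>x. - w * \<psi> x) \<phi>" "primitive (\<lambda>x. w * (h x * \<phi> x)) \<psi>"
    "\<phi> 0 = 1" "\<psi> 0 = 0" "\<phi> l = r * cos (\<theta> l)" "\<psi> l = r * sin (\<theta> l)"
proof -
  note p = conjunct1[OF a[unfolded is_angle_def]]
  note cont = primitiveD(1)[OF p]
  \<comment> \<open>The logarithmic derivative of the radius, from differentiating
    \<open>\<phi>\<^sup>2 + \<psi>\<^sup>2\<close> along the system.\<close>
  define f where "f x = w * ((h x - 1) * (sin (\<theta> x) * cos (\<theta> x)))" for x
  have "tame f"
    unfolding f_def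
    by (intro tame_mult tame_diff tame_const tame_h tame_continuous continuous_intros cont)
  then obtain R where R: "primitive f R" "R 0 = 0"
    using tame_has_primitive by force
  note R_cont = primitiveD(1)[OF R(1)]
  define \<phi> where "\<phi> x = exp (R x) * cos (\<theta> x)" for x
  define \<psi> where "\<psi> x = exp (R x) * sin (\<theta> x)" for x
  have "primitive (\<lambda>x. - w * \<psi> x) \<phi>"
    unfolding primitive_def
  proof (intro conjI ballI)
    show "continuous_on {0..l} \<phi>"
      unfolding \<phi>_def by (intro continuous_intros cont R_cont)
    fix x assume x: "x \<in> {0..l} - C"
    have "(\<phi> has_real_derivative exp (R x) * f x * cos (\<theta> x)
        + - sin (\<theta> x) * (w * slope x (\<theta> x)) * exp (R x)) (at x)"
      unfolding \<phi>_def by (auto intro!: derivative_eq_intros primitiveD(2)[OF R(1) x] primitiveD(2)[OF p x])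
    also have "exp (R x) * f x * cos (\<theta> x) + - sin (\<theta> x) * (w * slope x (\<theta> x)) * exp (R x)
        = - w * (exp (R x) * sin (\<theta> x)) * ((sin (\<theta> x))\<^sup>2 + (cos (\<theta> x))\<^sup>2)"
      unfolding f_def slope_def by (simp only: power2_eq_square) algebra
    also have "\<dots> = - w * \<psi> x"
      by (simp add: \<psi>_def)
    finally show "(\<phi> has_real_derivative - w * \<psi> x) (at x)" .
  qed
  moreover have "primitive (\<lambda>x. w * (h x * \<phi> x)) \<psi>"
    unfolding primitive_def
  proof (intro conjI ballI)
    show "continuous_on {0..l} \<psi>"
      unfolding \<psi>_def by (intro continuous_intros cont R_cont)
    fix x assume x: "x \<in> {0..l} - C"
    have "(\<psi> has_real_derivative exp (R x) * f x * sin (\<theta> x)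
        + cos (\<theta> x) * (w * slope x (\<theta> x)) * exp (R x)) (at x)"
      unfolding \<psi>_def by (auto intro!: derivative_eq_intros primitiveD(2)[OF R(1) x] primitiveD(2)[OF p x])
    also have "exp (R x) * f x * sin (\<theta> x) + cos (\<theta> x) * (w * slope x (\<theta> x)) * exp (R x)
        = w * (h x * (exp (R x) * cos (\<theta> x))) * ((sin (\<theta> x))\<^sup>2 + (cos (\<theta> x))\<^sup>2)"
      unfolding f_def slope_def by (simp only: power2_eq_square) algebra
    also have "\<dots> = w * (h x * \<phi> x)"
      by (simp add: \<phi>_def)
    finally show "(\<psi> has_real_derivative w * (h x * \<phi> x)) (at x)" .
  qed
  ultimately show thesis
    using a R(2) by (intro that[of \<psi> \<phi> "exp (R l)"]) (simp_all add: \<phi>_def \<psi>_def is_angle_def)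
qed

end

subsection \<open>Pure tones\<close>

text \<open>At \<open>l\<close> the shifted tones are \<open>r * cos a * cos (w * t - a)\<close> and
  \<open>r * sin a * sin (w * t - a)\<close> with \<open>a\<close> a multiple of a quarter turn. For
  even \<open>k\<close> the second vanishes and the first is even in time; for odd \<open>k\<close>
  the roles are exchanged.\<close>

lemma tone_boundary_conditions:
  assumes "0 < w" and "\<psi> 0 = 0"
    and \<phi>l: "\<phi> l = r * cos (real k * (pi / 2))" and \<psi>l: "\<psi> l = r * sin (real k * (pi / 2))"
  shows "boundary_conditions l (period k w) (tone_P w \<phi>) (tone_U w \<psi>)"
proof -
  define a where "a = real k * (pi / 2)"
  have shift: "w * (t - period k w / 4) = w * t - a" for t
    using \<open>0 < w\<close> by (simp add: period_def a_def field_simps)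
  have "sin (2 * a) = 0"
    by (simp add: a_def mult.commute[of "real k"])
  then have sc: "sin a * cos a = 0"
    by (simp add: sin_double)
  \<comment> \<open>Both odd parts reduce to a multiple of \<open>sin a * cos a\<close>, which
    treats the two parities of \<open>k\<close> at once.\<close>
  have "sin a * (sin (w * t - a) - sin (w * (- t) - a)) = 2 * sin (w * t) * (sin a * cos a)"
    and "cos a * (cos (w * t - a) - cos (w * (- t) - a)) = 2 * sin (w * t) * (sin a * cos a)" for t
    by (simp_all add: sin_diff cos_diff algebra_simps)
  then have "sin a * sin (w * t - a) = sin a * sin (w * (- t) - a)"
    and "cos a * cos (w * t - a) = cos a * cos (w * (- t) - a)" for t
    unfolding sc by (simp_all add: right_diff_distrib)
  then show ?thesis
    using \<open>\<psi> 0 = 0\<close>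
    unfolding boundary_conditions_def odd_part_def shift_def reflect_def tone_P_def tone_U_def shift
      \<phi>l \<psi>l a_def[symmetric]
    by (simp add: mult.assoc)
qed

context weight
begin

text \<open>The eigenfunctions belong to \<open>h\<close>, but \<open>\<sigma>\<^sup>2 = h\<close>
  almost everywhere and \<open>C\<close> is a null set, so they also solve the equations for
  \<open>\<sigma>\<close> almost everywhere.\<close>

lemma pure_tone_exists:
  assumes w: "0 < w" and a: "is_angle w \<theta>" "\<theta> l = real k * (pi / 2)"
    and \<sigma>: "AE x in lebesgue. x \<in> {0..l} \<longrightarrow> (\<sigma> x)\<^sup>2 = h x"
  shows "\<exists>\<phi> \<psi>. SL_eigenfunction l \<sigma> k (w\<^sup>2) \<phi> \<and> first_order_system l \<sigma> w \<phi> \<psi> \<and>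
     solves_linear_wave l \<sigma> (tone_P w \<phi>) (tone_U w \<psi>) \<and>
     boundary_conditions l (period k w) (tone_P w \<phi>) (tone_U w \<psi>)"
proof -
  obtain \<phi> \<psi> r where \<phi>: "primitive (\<lambda>x. - w * \<psi> x) \<phi>" and \<psi>: "primitive (\<lambda>x. w * (h x * \<phi> x)) \<psi>"
    and init: "\<phi> 0 = 1" "\<psi> 0 = 0" and final: "\<phi> l = r * cos (\<theta> l)" "\<psi> l = r * sin (\<theta> l)"
    using eigenfunctions_exist[OF a(1)] by blast
  note cont = primitiveD(1)[OF \<phi>] primitiveD(1)[OF \<psi>]
  \<comment> \<open>The factor \<open>c\<close> will be \<open>cos (w * t)\<close> or
    \<open>sin (w * t)\<close> at a fixed time.\<close>
  have ac_mult: "abs_continuous_on {0..l} (\<lambda>x. \<phi> x * c)" "abs_continuous_on {0..l} (\<lambda>x. \<psi> x * c)" for c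
    by (intro tame_primitive_abs_continuous[OF _ primitive_mult_const[OF \<phi>]]
        tame_primitive_abs_continuous[OF _ primitive_mult_const[OF \<psi>]]
        tame_mult tame_const tame_h tame_continuous[OF cont(1)] tame_continuous[OF cont(2)])+
  have ac: "abs_continuous_on {0..l} \<phi>" "abs_continuous_on {0..l} \<psi>"
    using ac_mult[of 1] by simp_all
  have "C \<in> null_sets lebesgue"
    using countable_C by (simp add: countable_imp_null_set_lborel null_sets_completionI)
  then have "AE x in lebesgue. x \<notin> C"
    by (rule AE_not_in)
  with \<sigma> have deriv: "AE x in lebesgue. x \<in> {0<..<l} \<longrightarrow>
      (\<phi> has_real_derivative - w * \<psi> x) (at x) \<and>
      (\<psi> has_real_derivative w * ((\<sigma> x)\<^sup>2 * \<phi> x)) (at x)"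
  proof eventually_elim
    case (elim x)
    then show ?case
      using primitiveD(2)[OF \<phi>, of x] primitiveD(2)[OF \<psi>, of x] by auto
  qed
  have bc: "boundary_conditions l (period k w) (tone_P w \<phi>) (tone_U w \<psi>)"
    using final unfolding a(2) by (intro tone_boundary_conditions w init)
  have "SL_eigenfunction l \<sigma> k (w\<^sup>2) \<phi>"
    unfolding SL_eigenfunction_def
  \<comment> \<open>With this derivative of \<open>\<phi>\<close>, the quotient
    \<open>- d\<phi> x / sqrt lam\<close> is \<open>\<psi>\<close> again, so \<open>bc\<close>
    applies.\<close>
  proof (intro conjI exI[of _ "\<lambda>x. - w * \<psi> x"] ballI)
    show "\<exists>x\<in>{0..l}. \<phi> x \<noteq> 0"
      using init l_pos by (intro bexI[of _ 0]) auto
    show "(\<phi> has_real_derivative - w * \<psi> x) (at x within {0..l})" if "x \<in> {0..l}" for x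
      by (intro primitive_continuous_deriv[OF \<phi> _ that] continuous_intros cont)
    show "abs_continuous_on {0..l} (\<lambda>x. - w * \<psi> x)"
      using ac_mult(2)[of "- w"] by (simp add: mult.commute)
    show "AE x in lebesgue. x \<in> {0<..<l} \<longrightarrow> (\<exists>dd\<phi>.
        ((\<lambda>x. - w * \<psi> x) has_real_derivative dd\<phi>) (at x) \<and> - dd\<phi> = w\<^sup>2 * (\<sigma> x)\<^sup>2 * \<phi> x)"
      using deriv
    proof (rule eventually_mono, intro impI)
      fix x assume "x \<in> {0<..<l} \<longrightarrow> (\<phi> has_real_derivative - w * \<psi> x) (at x) \<and>
        (\<psi> has_real_derivative w * ((\<sigma> x)\<^sup>2 * \<phi> x)) (at x)" "x \<in> {0<..<l}"
      then have "(\<psi> has_real_derivative w * ((\<sigma> x)\<^sup>2 * \<phi> x)) (at x)" by blast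
      from DERIV_cmult[OF this, of "- w"]
      show "\<exists>dd\<phi>. ((\<lambda>x. - w * \<psi> x) has_real_derivative dd\<phi>) (at x) \<and>
          - dd\<phi> = w\<^sup>2 * (\<sigma> x)\<^sup>2 * \<phi> x"
        by (intro exI conjI) (auto simp: power2_eq_square)
    qed
    show "boundary_conditions l (period k (sqrt (w\<^sup>2))) (tone_P (sqrt (w\<^sup>2)) \<phi>)
        (tone_U (sqrt (w\<^sup>2)) (\<lambda>x. - (- w * \<psi> x) / sqrt (w\<^sup>2)))"
      using w bc by simp
  qed (use w in simp)
  moreover have "first_order_system l \<sigma> w \<phi> \<psi>"
    unfolding first_order_system_def
  proof (intro conjI ac)
    show "AE x in lebesgue. x \<in> {0<..<l} \<longrightarrow> (\<exists>d\<phi> d\<psi>.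
        (\<phi> has_real_derivative d\<phi>) (at x) \<and> (\<psi> has_real_derivative d\<psi>) (at x) \<and>
        d\<phi> + w * \<psi> x = 0 \<and> d\<psi> - (\<sigma> x)\<^sup>2 * w * \<phi> x = 0)"
      using deriv
    proof eventually_elim
      case (elim x)
      show ?case
      proof
        assume "x \<in> {0<..<l}"
        with elim show "\<exists>d\<phi> d\<psi>. (\<phi> has_real_derivative d\<phi>) (at x) \<and>
            (\<psi> has_real_derivative d\<psi>) (at x) \<and>
            d\<phi> + w * \<psi> x = 0 \<and> d\<psi> - (\<sigma> x)\<^sup>2 * w * \<phi> x = 0"
          by (intro exI[of _ "- w * \<psi> x"] exI[of _ "w * ((\<sigma> x)\<^sup>2 * \<phi> x)"]) simp
      qed
    qed
  qed
  moreover have "solves_linear_wave l \<sigma> (tone_P w \<phi>) (tone_U w \<psi>)"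
    unfolding solves_linear_wave_def tone_P_def tone_U_def
  proof (intro conjI allI ac_mult)
    show "AE x in lebesgue. x \<in> {0<..<l} \<longrightarrow> (\<forall>t. \<exists>Px Pt Ux Ut.
        ((\<lambda>y. \<phi> y * cos (w * t)) has_real_derivative Px) (at x) \<and>
        ((\<lambda>\<tau>. \<phi> x * cos (w * \<tau>)) has_real_derivative Pt) (at t) \<and>
        ((\<lambda>y. \<psi> y * sin (w * t)) has_real_derivative Ux) (at x) \<and>
        ((\<lambda>\<tau>. \<psi> x * sin (w * \<tau>)) has_real_derivative Ut) (at t) \<and>
        Px + Ut = 0 \<and> Ux + (\<sigma> x)\<^sup>2 * Pt = 0)"
      using deriv
    proof eventually_elim
      case (elim x)
      show ?case
      proof (intro impI allI)
        fix t
        assume "x \<in> {0<..<l}"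
        with elim have d: "(\<phi> has_real_derivative - w * \<psi> x) (at x)"
          "(\<psi> has_real_derivative w * ((\<sigma> x)\<^sup>2 * \<phi> x)) (at x)" by blast+
        have "((\<lambda>\<tau>. \<phi> x * cos (w * \<tau>)) has_real_derivative \<phi> x * (- sin (w * t) * w)) (at t)"
          "((\<lambda>\<tau>. \<psi> x * sin (w * \<tau>)) has_real_derivative \<psi> x * (cos (w * t) * w)) (at t)"
          by (auto intro!: derivative_eq_intros)
        then show "\<exists>Px Pt Ux Ut.
            ((\<lambda>y. \<phi> y * cos (w * t)) has_real_derivative Px) (at x) \<and>
            ((\<lambda>\<tau>. \<phi> x * cos (w * \<tau>)) has_real_derivative Pt) (at t) \<and>
            ((\<lambda>y. \<psi> y * sin (w * t)) has_real_derivative Ux) (at x) \<and>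
            ((\<lambda>\<tau>. \<psi> x * sin (w * \<tau>)) has_real_derivative Ut) (at t) \<and>
            Px + Ut = 0 \<and> Ux + (\<sigma> x)\<^sup>2 * Pt = 0"
          using DERIV_cmult_right[OF d(1), of "cos (w * t)"] DERIV_cmult_right[OF d(2), of "sin (w * t)"]
          by (intro exI conjI) (assumption | simp)+
      qed
    qed
  qed
  ultimately show ?thesis
    using bc by blast
qed

end

section \<open>The sequence of pure tones\<close>

theorem theorem1p2:
  fixes v :: "real \<Rightarrow> real \<Rightarrow> real" and l pbar :: real and s \<sigma> :: "real \<Rightarrow> real"
  assumes "constitutive_law v"
    and "l > 0" and "pbar > 0"
    and "s \<in> entropy_profiles v pbar l"
    and "\<sigma> = inv_wavespeed v pbar s"
  shows "\<exists>(\<omega> :: nat \<Rightarrow> real) (\<phi> :: nat \<Rightarrow> real \<Rightarrow> real) (\<psi> :: nat \<Rightarrow> real \<Rightarrow> real).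
    strict_mono_on {1..} \<omega> \<and>
    bounded ((\<lambda>k. \<omega> k / real k) ` {1..}) \<and>
    (\<forall>k\<ge>1.
      eigenfrequency l \<sigma> k (\<omega> k) \<and>
      SL_eigenfunction l \<sigma> k ((\<omega> k)\<^sup>2) (\<phi> k) \<and>
      first_order_system l \<sigma> (\<omega> k) (\<phi> k) (\<psi> k) \<and>
      solves_linear_wave l \<sigma> (tone_P (\<omega> k) (\<phi> k)) (tone_U (\<omega> k) (\<psi> k)) \<and>
      boundary_conditions l (period k (\<omega> k)) (tone_P (\<omega> k) (\<phi> k)) (tone_U (\<omega> k) (\<psi> k)))"
proof -
  have \<sigma>_pos: "0 < \<sigma> x" for x
    using assms(1,3) by (simp add: assms(5) inv_wavespeed_def constitutive_law_def)
  obtain g where g: "finite_variation_on {0..l} g"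
    and ln_\<sigma>: "AE x in lebesgue. x \<in> {0..l} \<longrightarrow> ln (\<sigma> x) = g x"
    using assms(4) by (auto simp: entropy_profiles_def BV_on_def assms(5))
  obtain B where B: "\<And>x. x \<in> {0..l} \<Longrightarrow> \<bar>g x\<bar> \<le> B"
    using finite_variation_on_bounded[OF g] by blast
  obtain C where C: "countable C" "\<And>x. x \<in> {0..l} - C \<Longrightarrow> isCont g x"
    using finite_variation_on_countable_discontinuities[OF g] by blast
  \<comment> \<open>The weight comes from the finite-variation representative \<open>g\<close> of
    \<open>ln \<sigma>\<close>: bounds on \<open>g\<close> become positive bounds on the
    weight.\<close>
  interpret weight l "C \<union> {0, l}" "\<lambda>x. (exp (g x))\<^sup>2" "(exp (- B))\<^sup>2" "(exp B)\<^sup>2"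
  proof
    fix x assume "x \<in> {0..l}"
    then have "- B \<le> g x" "g x \<le> B" using B[of x] by auto
    then show "(exp (- B))\<^sup>2 \<le> (exp (g x))\<^sup>2 \<and> (exp (g x))\<^sup>2 \<le> (exp B)\<^sup>2"
      by (auto intro!: power_mono)
  next
    fix x assume "x \<in> {0..l} - (C \<union> {0, l})"
    then have "isCont g x" using C by auto
    then show "isCont (\<lambda>x. (exp (g x))\<^sup>2) x" by (intro continuous_intros)
  qed (use assms(2) C(1) in auto)
  have \<sigma>: "AE x in lebesgue. x \<in> {0..l} \<longrightarrow> (\<sigma> x)\<^sup>2 = (exp (g x))\<^sup>2"
    using ln_\<sigma>
  proof eventually_elim
    case (elim x)
    then show ?case using \<sigma>_pos[of x] by (metis exp_ln)
  qed
  \<comment> \<open>A lower bound for the angle at \<open>l\<close> per unit of frequency.\<close>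
  define c where "c = min ((exp (- B))\<^sup>2) 1 * l"
  have "c > 0" using assms(2) by (simp add: c_def)
  \<comment> \<open>The guard \<open>1 \<le> k\<close> excludes the target angle zero, which no
    positive frequency attains; \<open>\<omega> 0\<close> stays arbitrary.\<close>
  have "\<forall>k. \<exists>w. 1 \<le> k \<longrightarrow> 0 < w \<and> w \<le> real k * (pi / 2) / c \<and> angle w l = real k * (pi / 2)"
  proof (intro allI)
    fix k :: nat
    show "\<exists>w. 1 \<le> k \<longrightarrow> 0 < w \<and> w \<le> real k * (pi / 2) / c \<and> angle w l = real k * (pi / 2)"
      using frequency_exists[of "real k * (pi / 2)"] unfolding c_def by (cases "1 \<le> k") auto
  qed
  then obtain \<omega> where \<omega>: "\<And>k. 1 \<le> k \<Longrightarrow> 0 < \<omega> k" "\<And>k. 1 \<le> k \<Longrightarrow> \<omega> k \<le> real k * (pi / 2) / c"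
      "\<And>k. 1 \<le> k \<Longrightarrow> angle (\<omega> k) l = real k * (pi / 2)"
    by metis
  have "\<forall>k. \<exists>\<phi> \<psi>. 1 \<le> k \<longrightarrow> SL_eigenfunction l \<sigma> k ((\<omega> k)\<^sup>2) \<phi> \<and>
      first_order_system l \<sigma> (\<omega> k) \<phi> \<psi> \<and>
      solves_linear_wave l \<sigma> (tone_P (\<omega> k) \<phi>) (tone_U (\<omega> k) \<psi>) \<and>
      boundary_conditions l (period k (\<omega> k)) (tone_P (\<omega> k) \<phi>) (tone_U (\<omega> k) \<psi>)"
    using pure_tone_exists[OF \<omega>(1) is_angle_angle \<omega>(3) \<sigma>] \<omega>(1) by (meson less_imp_le)
  then obtain \<phi> \<psi> where modes: "\<And>k. 1 \<le> k \<Longrightarrow> SL_eigenfunction l \<sigma> k ((\<omega> k)\<^sup>2) (\<phi> k) \<and>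
      first_order_system l \<sigma> (\<omega> k) (\<phi> k) (\<psi> k) \<and>
      solves_linear_wave l \<sigma> (tone_P (\<omega> k) (\<phi> k)) (tone_U (\<omega> k) (\<psi> k)) \<and>
      boundary_conditions l (period k (\<omega> k)) (tone_P (\<omega> k) (\<phi> k)) (tone_U (\<omega> k) (\<psi> k))"
    by metis
  have "eigenfrequency l \<sigma> k (\<omega> k)" if "1 \<le> k" for k
    using modes[OF that] \<omega>(1)[OF that] unfolding eigenfrequency_def
    by (intro exI[of _ "(\<omega> k)\<^sup>2"] exI[of _ "\<phi> k"]) simp
  moreover have "strict_mono_on {1..} \<omega>"
  proof (rule strict_mono_onI, rule ccontr)
    fix j k :: nat
    \<comment> \<open>Monotonicity of the angle suffices for strictness because the prescribed
      angles at \<open>l\<close> are strictly increasing in the index.\<close>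
    assume jk: "j \<in> {1..}" "k \<in> {1..}" "j < k" "\<not> \<omega> j < \<omega> k"
    then have "angle (\<omega> k) l \<le> angle (\<omega> j) l"
      using \<omega>(1)[of k] by (intro angle_mono) auto
    then have "real k * (pi / 2) \<le> real j * (pi / 2)"
      using \<omega>(3)[of j] \<omega>(3)[of k] jk(1,2) by (metis atLeast_iff)
    then show False
      using jk(3) by simp
  qed
  moreover have "bounded ((\<lambda>k. \<omega> k / real k) ` {1..})"
    unfolding bounded_iff
  proof (intro exI[of _ "pi / 2 / c"] ballI)
    fix y assume "y \<in> (\<lambda>k. \<omega> k / real k) ` {1..}"
    then obtain k where k: "1 \<le> k" "y = \<omega> k / real k" by auto
    then show "norm y \<le> pi / 2 / c"
      using \<omega>(1,2)[OF k(1)] by (simp add: divide_le_eq mult.commute)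
  qed
  ultimately show ?thesis
    using modes by blast
qed

end
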